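(* Let $\alpha$ be a real number. (a) If $\alpha\ge4$, then for all $x\in(0,1)$ the inequality $$\frac{(2+\alpha)\bigl(\sqrt{1+x}-\sqrt{1-x}\bigr)}{\alpha+\sqrt{1+x}+\sqrt{1-x}}<\arcsin x<\frac{\frac{\pi(\sqrt2+\alpha)}{2\sqrt2}\bigl(\sqrt{1+x}-\sqrt{1-x}\bigr)}{\alpha+\sqrt{1+x}+\sqrt{1-x}}$$ holds. (b) If $4>\alpha>\frac{4(\pi-2)}{\sqrt{2}\,(4-\pi)}$, then for all $x\in(0,1)$ $$\arcsin x<\frac{\max\Bigl\{2+\alpha,\ \frac{\pi(\sqrt2+\alpha)}{2\sqrt2}\Bigr\}\bigl(\sqrt{1+x}-\sqrt{1-x}\bigr)}{\alpha+\sqrt{1+x}+\sqrt{1-x}}.$$ (c) If $\alpha\le\frac{4(\pi-2)}{\sqrt{2}\,(4-\pi)}$, then the double inequality of (a) reverses, that is, for all $x\in(0,1)$ $$\frac{(2+\alpha)\bigl(\sqrt{1+x}-\sqrt{1-x}\bigr)}{\alpha+\sqrt{1+x}+\sqrt{1-x}}>\arcsin x>\frac{\frac{\pi(\sqrt2+\alpha)}{2\sqrt2}\bigl(\sqrt{1+x}-\sqrt{1-x}\bigr)}{\alpha+\sqrt{1+x}+\sqrt{1-x}}.$$ Moreover, the constants $2+\alpha$ and $\frac{\pi(\sqrt2+\alpha)}{2\sqrt2}$ in the double inequality of (a), and the scalar $\max\bigl\{2+\alpha,\frac{\pi(\sqrt2+\alpha)}{2\sqrt2}\bigr\}$ in the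 inequality of (b), are the best possible.
   Context: Here $\arcsin$ is the principal inverse sine. "Best possible" means that, for each fixed $\alpha$ in the relevant range, the inequality in question fails to hold for all $x\in(0,1)$ if the constant is replaced by any constant (depending only on $\alpha$) giving a strictly sharper bound: a constant in a lower bound for $\arcsin x$ cannot be replaced by a larger one, and a constant in an upper bound cannot be replaced by a smaller one.
   Formalization: In (c) the reversed inequality is stated only for those x in (0,1) with α+√(1+x)+√(1−x)>0 (automatic when α≥−√2); elsewhere it is false or undefined, e.g. for α=−2 it would claim 0>arcsin x. *)

theory Defs
  imports Complex_Main
begin

text \<open>Note that \<open>x / 0 = 0\<close> in HOL, and that the denominator below is positive on \<open>(0,1)\<close>
  exactly when \<open>\<alpha> \<ge> - sqrt 2\<close>, since \<open>sqrt (1 + x) + sqrt (1 - x)\<close> has range \<open>(sqrt 2, 2)\<close> there.\<close>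

definition shafer_fink :: "real \<Rightarrow> real \<Rightarrow> real \<Rightarrow> real" where
  "shafer_fink C \<alpha> x =
     C * (sqrt (1 + x) - sqrt (1 - x)) / (\<alpha> + sqrt (1 + x) + sqrt (1 - x))"

definition const_zero :: "real \<Rightarrow> real" where
  "const_zero \<alpha> = 2 + \<alpha>"

definition const_one :: "real \<Rightarrow> real" where
  "const_one \<alpha> = pi * (sqrt 2 + \<alpha>) / (2 * sqrt 2)"

definition alpha_crit :: real where
  "alpha_crit = 4 * (pi - 2) / (sqrt 2 * (4 - pi))"

end

theory Submission
  imports Defs "HOL-Real_Asymp.Real_Asymp"
begin

text \<open>
  Put \<open>x = sin (2 * t)\<close> with \<open>0 < t < pi / 4\<close>. All the inequalities then compare the constant with
  \<open>F t = t * (\<alpha> + 2 * cos t) / sin t\<close>, which tends to \<open>2 + \<alpha>\<close> at \<open>0\<close> and to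
  \<open>pi * (sqrt 2 + \<alpha>) / (2 * sqrt 2)\<close> at \<open>pi / 4\<close>. The derivative of \<open>F\<close> has the sign of
  \<open>\<alpha> - g t\<close> with \<open>g t = (2 * t - sin (2 * t)) / (sin t - t * cos t)\<close>. By the monotone form of
  l'Hopital's rule \<open>g\<close> decreases, like the quotient \<open>4 * sin t / t\<close> of the derivatives, from
  \<open>4\<close> to \<open>alpha_crit\<close>.
\<close>

definition sf_quot :: "real \<Rightarrow> real \<Rightarrow> real" where
  "sf_quot \<alpha> t = t * (\<alpha> + 2 * cos t) / sin t"

definition sf_threshold :: "real \<Rightarrow> real" where
  "sf_threshold t = (2 * t - sin (2 * t)) / (sin t - t * cos t)"

section \<open>Monotonicity of \<open>sin t / t\<close>\<close>

lemma x_cos_less_sin: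
  fixes t :: real
  assumes "0 < t" "t < pi"
  shows "t * cos t < sin t"
proof -
  have "(\<lambda>t. sin t - t * cos t) 0 < (\<lambda>t. sin t - t * cos t) t"
  proof (rule DERIV_pos_imp_increasing_open[OF assms(1)])
    fix s :: real assume s: "0 < s" "s < t"
    have "((\<lambda>t. sin t - t * cos t) has_real_derivative s * sin s) (at s)"
      by (auto intro!: derivative_eq_intros)
    moreover have "s * sin s > 0"
      using s assms by (intro mult_pos_pos sin_gt_zero) auto
    ultimately show "\<exists>y. ((\<lambda>t. sin t - t * cos t) has_real_derivative y) (at s) \<and> 0 < y"
      by blast
  qed (auto intro!: continuous_intros)
  then show ?thesis by simp
qed

lemma sin_div_self_strict_antimono:
  fixes s t :: real
  assumes "0 < s" "s < t" "t < pi"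
  shows "sin t / t < sin s / s"
proof (rule DERIV_neg_imp_decreasing[OF assms(2)])
  fix u :: real assume u: "s \<le> u" "u \<le> t"
  then have u': "0 < u" "u < pi" using assms by auto
  have "((\<lambda>u. sin u / u) has_real_derivative (u * cos u - sin u) / u\<^sup>2) (at u)"
    using u' by (auto intro!: derivative_eq_intros simp: field_simps power2_eq_square)
  moreover have "(u * cos u - sin u) / u\<^sup>2 < 0"
    using x_cos_less_sin[OF u'] u' by (simp add: divide_less_0_iff)
  ultimately show "\<exists>y. ((\<lambda>u. sin u / u) has_real_derivative y) (at u) \<and> y < 0"
    by blast
qed

section \<open>Values and monotonicity of \<open>sf_threshold\<close>\<close>

lemma DERIV_threshold_num:
  "((\<lambda>t. 2 * t - sin (2 * t)) has_real_derivative 4 * (sin t)\<^sup>2) (at t)"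
  by (auto intro!: derivative_eq_intros simp: cos_double_sin)

lemma DERIV_threshold_den:
  "((\<lambda>t. sin t - t * cos t) has_real_derivative t * sin t) (at t)"
  by (auto intro!: derivative_eq_intros)

text \<open>Cauchy's mean value theorem on the interval from 0 to t: numerator and denominator both
  vanish at 0, and their derivatives at c have quotient
  \<open>4 * (sin c)^2 / (c * sin c)\<close>.\<close>

lemma sf_threshold_mean_value:
  assumes "0 < t" "t < pi"
  obtains c where "0 < c" "c < t" "sf_threshold t = 4 * (sin c / c)"
proof -
  obtain c where c: "0 < c" "c < t"
    and eq: "(2 * t - sin (2 * t) - (2 * 0 - sin (2 * 0))) * (c * sin c) =
             (sin t - t * cos t - (sin 0 - 0 * cos 0)) * (4 * (sin c)\<^sup>2)"
    using GMVT'[OF assms(1), of "\<lambda>t. 2 * t - sin (2 * t)" "\<lambda>t. sin t - t * cos t"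
        "\<lambda>t. t * sin t" "\<lambda>t. 4 * (sin t)\<^sup>2"] DERIV_threshold_num DERIV_threshold_den
    by (force intro!: continuous_intros)
  have "sin c > 0" using c assms by (intro sin_gt_zero) auto
  then have "(2 * t - sin (2 * t)) * c = (sin t - t * cos t) * (4 * sin c)"
    using eq by (simp add: power2_eq_square)
  then have "sf_threshold t = 4 * (sin c / c)"
    using x_cos_less_sin[OF assms] c unfolding sf_threshold_def by (simp add: field_simps)
  then show thesis using that c by blast
qed

lemma sf_threshold_less_4:
  assumes "0 < t" "t < pi"
  shows "sf_threshold t < 4"
proof -
  obtain c where c: "0 < c" "c < t" "sf_threshold t = 4 * (sin c / c)"
    using sf_threshold_mean_value[OF assms] by blast
  \<comment> \<open>Passing to \<open>c / 2\<close> makes the bound strict, since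
    \<open>sin_x_le_x\<close> alone gives only \<le>.\<close>
  then have "sin c / c < sin (c / 2) / (c / 2)"
    using assms by (intro sin_div_self_strict_antimono) auto
  also have "\<dots> \<le> 1" using c sin_x_le_x[of "c / 2"] by simp
  finally show ?thesis using c(3) by linarith
qed

text \<open>The mean value point c lies to the left of u, so the quotient at u equals
  \<open>4 * (sin c / c)\<close> and exceeds the quotient \<open>4 * (sin u / u)\<close> of the
  derivatives at u. This makes the numerator in the quotient rule negative.\<close>

lemma sf_threshold_strict_antimono:
  assumes "0 < s" "s < t" "t < pi"
  shows "sf_threshold t < sf_threshold s"
proof (rule DERIV_neg_imp_decreasing[OF assms(2)])
  fix u :: real assume u: "s \<le> u" "u \<le> t"
  then have u': "0 < u" "u < pi" using assms by auto
  let ?N = "2 * u - sin (2 * u)" and ?M = "sin u - u * cos u"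
  have M: "?M > 0" using x_cos_less_sin[OF u'] by simp
  have sin: "sin u > 0" using u' by (intro sin_gt_zero)
  have "(sf_threshold has_real_derivative
          (4 * (sin u)\<^sup>2 * ?M - ?N * (u * sin u)) / (?M * ?M)) (at u)"
    unfolding sf_threshold_def[abs_def]
    using M by (intro DERIV_divide DERIV_threshold_num DERIV_threshold_den) auto
  moreover have "(4 * (sin u)\<^sup>2 * ?M - ?N * (u * sin u)) / (?M * ?M) < 0"
  proof -
    obtain c where c: "0 < c" "c < u" "sf_threshold u = 4 * (sin c / c)"
      using sf_threshold_mean_value[OF u'] by blast
    have "4 * (sin u / u) < ?N / ?M"
      using sin_div_self_strict_antimono[of c u] c u' by (simp add: sf_threshold_def)
    then have "4 * sin u * ?M < ?N * u"
      using M u' by (simp add: field_simps)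
    then have "sin u * (4 * sin u * ?M) < sin u * (?N * u)"
      using sin by simp
    then have "4 * (sin u)\<^sup>2 * ?M - ?N * (u * sin u) < 0"
      by (simp add: power2_eq_square algebra_simps)
    then show ?thesis using M by (simp add: divide_less_0_iff)
  qed
  ultimately show "\<exists>y. (sf_threshold has_real_derivative y) (at u) \<and> y < 0"
    by blast
qed

lemma sf_threshold_pi_4: "sf_threshold (pi / 4) = alpha_crit"
proof -
  have "pi < 4" using pi_less_4 .
  \<comment> \<open>Numerator and denominator of \<open>alpha_crit\<close> are 8 times those of
    \<open>sf_threshold (pi / 4)\<close>.\<close>
  moreover have "sqrt 2 * (4 - pi) = 4 * (sqrt 2 / 2 - pi / 4 * (sqrt 2 / 2)) * 2"
    by (simp add: algebra_simps)
  ultimately show ?thesis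
    unfolding sf_threshold_def alpha_crit_def sin_45 cos_45
    by (simp add: field_simps)
qed

lemma alpha_crit_nonneg: "alpha_crit \<ge> 0"
  using pi_ge_two pi_less_4 unfolding alpha_crit_def
  by (intro divide_nonneg_nonneg mult_nonneg_nonneg) auto

section \<open>Derivative and monotonicity of \<open>sf_quot\<close>\<close>

lemma DERIV_sf_quot:
  assumes "0 < t" "t < pi"
  shows "(sf_quot \<alpha> has_real_derivative
           (\<alpha> - sf_threshold t) * ((sin t - t * cos t) / (sin t)\<^sup>2)) (at t)"
proof -
  have sin: "sin t > 0" using assms by (intro sin_gt_zero)
  have M: "sin t - t * cos t > 0" using x_cos_less_sin[OF assms] by simp
  have "(sf_quot \<alpha> has_real_derivative
          ((\<alpha> + 2 * cos t - 2 * t * sin t) * sin t - t * (\<alpha> + 2 * cos t) * cos t) /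
            (sin t * sin t)) (at t)"
    unfolding sf_quot_def[abs_def]
    using sin by (auto intro!: derivative_eq_intros)
  moreover have "(\<alpha> + 2 * cos t - 2 * t * sin t) * sin t - t * (\<alpha> + 2 * cos t) * cos t =
                 (\<alpha> - sf_threshold t) * (sin t - t * cos t)"
  proof -
    have "(\<alpha> - sf_threshold t) * (sin t - t * cos t) =
          \<alpha> * (sin t - t * cos t) - (2 * t - sin (2 * t))"
      unfolding sf_threshold_def left_diff_distrib[of \<alpha>]
      \<comment> \<open>The substituted equation is the cancellation \<open>b / c * c = b\<close>
        for nonzero c.\<close>
      by (subst nonzero_eq_divide_eq[THEN iffD1, OF _ refl]) (use M in auto)
    \<comment> \<open>The factor \<open>(sin t)\<^sup>2 + (cos t)\<^sup>2\<close> is inserted so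
      that the remaining identity is polynomial in t, \<open>sin t\<close> and
      \<open>cos t\<close>.\<close>
    also have "\<dots> = \<alpha> * (sin t - t * cos t) + 2 * sin t * cos t
                   - 2 * t * ((sin t)\<^sup>2 + (cos t)\<^sup>2)"
      by (simp add: sin_double)
    also have "\<dots> = (\<alpha> + 2 * cos t - 2 * t * sin t) * sin t - t * (\<alpha> + 2 * cos t) * cos t"
      by algebra
    finally show ?thesis by simp
  qed
  ultimately show ?thesis by (simp add: power2_eq_square)
qed

text \<open>As \<open>sf_threshold\<close> decreases, the bound at the left endpoint s holds
  strictly on the interior, where the derivative is therefore positive. In
  \<open>sf_quot_greater\<close> the bound sits at the right endpoint for the same reason.\<close>

lemma sf_quot_less:
  assumes "0 < s" "s < t" "t < pi" and "sf_threshold s \<le> \<alpha>"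
  shows "sf_quot \<alpha> s < sf_quot \<alpha> t"
proof (rule DERIV_pos_imp_increasing_open[OF assms(2)])
  fix u assume u: "s < u" "u < t"
  then have "sf_threshold u < \<alpha>"
    using sf_threshold_strict_antimono[of s u] assms by auto
  then have "(\<alpha> - sf_threshold u) * ((sin u - u * cos u) / (sin u)\<^sup>2) > 0"
    using x_cos_less_sin[of u] sin_gt_zero[of u] u assms by simp
  then show "\<exists>y. (sf_quot \<alpha> has_real_derivative y) (at u) \<and> 0 < y"
    using DERIV_sf_quot[of u \<alpha>] u assms by auto
next
  show "continuous_on {s..t} (sf_quot \<alpha>)"
    by (rule DERIV_continuous_on, rule has_field_derivative_at_within, rule DERIV_sf_quot)
      (use assms in auto)
qed

lemma sf_quot_greater:
  assumes "0 < s" "s < t" "t < pi" and "\<alpha> \<le> sf_threshold t"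
  shows "sf_quot \<alpha> t < sf_quot \<alpha> s"
proof (rule DERIV_neg_imp_decreasing_open[OF assms(2)])
  fix u assume u: "s < u" "u < t"
  then have "\<alpha> < sf_threshold u"
    using sf_threshold_strict_antimono[of u t] assms by auto
  then have "(\<alpha> - sf_threshold u) * ((sin u - u * cos u) / (sin u)\<^sup>2) < 0"
    using x_cos_less_sin[of u] sin_gt_zero[of u] u assms
    by (intro mult_neg_pos) simp_all
  then show "\<exists>y. (sf_quot \<alpha> has_real_derivative y) (at u) \<and> y < 0"
    using DERIV_sf_quot[of u \<alpha>] u assms by auto
next
  show "continuous_on {s..t} (sf_quot \<alpha>)"
    by (rule DERIV_continuous_on, rule has_field_derivative_at_within, rule DERIV_sf_quot)
      (use assms in auto)
qed

section \<open>Endpoint limits of \<open>sf_quot\<close> and the resulting bounds\<close>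

lemma sf_quot_tendsto_0: "(sf_quot \<alpha> \<longlongrightarrow> const_zero \<alpha>) (at_right 0)"
  unfolding sf_quot_def[abs_def] const_zero_def
  by real_asymp

lemma sf_quot_pi_4: "sf_quot \<alpha> (pi / 4) = const_one \<alpha>"
  by (simp add: sf_quot_def const_one_def sin_45 cos_45 field_simps)

text \<open>Here the limit is a value, since \<open>sf_quot\<close> is continuous at
  \<open>pi / 4\<close>. At 0 the formula is 0/0 with default value 0, so there only the limit is
  meaningful.\<close>

lemma sf_quot_tendsto_pi_4: "(sf_quot \<alpha> \<longlongrightarrow> const_one \<alpha>) (at_left (pi / 4))"
proof -
  have "isCont (sf_quot \<alpha>) (pi / 4)"
    by (rule DERIV_isCont, rule DERIV_sf_quot) simp_all
  then show ?thesis
    unfolding isCont_def sf_quot_pi_4 by (rule tendsto_within_subset) simp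
qed

lemma eventually_at_left_pi_4: "eventually (\<lambda>t. t \<in> {0<..<pi / 4}) (at_left (pi / 4))"
  by (rule eventually_at_leftI[of 0]) auto

lemma eventually_at_right_0_pi_4: "eventually (\<lambda>t. t \<in> {0<..<pi / 4}) (at_right 0)"
  by (rule eventually_at_rightI[of _ "pi / 4"]) auto

lemma const_zero_less_sf_quot:
  assumes "0 < t" "t < pi" "4 \<le> \<alpha>"
  shows "const_zero \<alpha> < sf_quot \<alpha> t"
proof -
  have inc: "sf_quot \<alpha> r < sf_quot \<alpha> s" if "0 < r" "r < s" "s \<le> t" for r s
    using that assms sf_threshold_less_4[of r] by (intro sf_quot_less) auto
  \<comment> \<open>Limits preserve only weak inequalities; the intermediate point
    \<open>t / 2\<close> restores strictness.\<close>
  have "const_zero \<alpha> \<le> sf_quot \<alpha> (t / 2)"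
  proof (rule tendsto_upperbound[OF sf_quot_tendsto_0])
    show "eventually (\<lambda>r. sf_quot \<alpha> r \<le> sf_quot \<alpha> (t / 2)) (at_right 0)"
      using assms by (intro eventually_at_rightI[of _ "t / 2"]) (auto intro!: less_imp_le inc)
  qed simp
  also have "\<dots> < sf_quot \<alpha> t" using assms by (intro inc) auto
  finally show ?thesis .
qed

lemma sf_quot_less_const_zero:
  assumes "0 < t" "t < pi" "\<alpha> \<le> sf_threshold t"
  shows "sf_quot \<alpha> t < const_zero \<alpha>"
proof -
  have dec: "sf_quot \<alpha> s < sf_quot \<alpha> r" if "0 < r" "r < s" "s \<le> t" for r s
    using that assms sf_threshold_strict_antimono[of s t]
    by (intro sf_quot_greater) (auto simp: order_le_less)
  have "sf_quot \<alpha> t < sf_quot \<alpha> (t / 2)" using assms by (intro dec) auto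
  also have "\<dots> \<le> const_zero \<alpha>"
  proof (rule tendsto_lowerbound[OF sf_quot_tendsto_0])
    show "eventually (\<lambda>r. sf_quot \<alpha> (t / 2) \<le> sf_quot \<alpha> r) (at_right 0)"
      using assms by (intro eventually_at_rightI[of _ "t / 2"]) (auto intro!: less_imp_le dec)
  qed simp
  finally show ?thesis .
qed

lemma sf_quot_less_const_one:
  assumes "0 < t" "t < pi / 4" "sf_threshold t \<le> \<alpha>"
  shows "sf_quot \<alpha> t < const_one \<alpha>"
  using sf_quot_less[of t "pi / 4" \<alpha>] assms by (simp add: sf_quot_pi_4)

lemma const_one_less_sf_quot:
  assumes "0 < t" "t < pi / 4" "\<alpha> \<le> alpha_crit"
  shows "const_one \<alpha> < sf_quot \<alpha> t"
  using sf_quot_greater[of t "pi / 4" \<alpha>] assms by (simp add: sf_quot_pi_4 sf_threshold_pi_4)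

section \<open>The substitution \<open>x = sin (2 * t)\<close>\<close>

lemma sqrt_one_plus_minus_sin_double:
  fixes t :: real
  assumes "0 < t" "t < pi / 4"
  shows "sqrt (1 + sin (2 * t)) = cos t + sin t" "sqrt (1 - sin (2 * t)) = cos t - sin t"
proof -
  \<comment> \<open>This selects \<open>cos t - sin t\<close> as the nonnegative root of its
    square.\<close>
  have "sin t < cos t"
  proof -
    have "sin t < sin (pi / 2 - t)"
      using assms by (intro sin_monotone_2pi) auto
    then show ?thesis by (simp add: sin_diff)
  qed
  moreover have "sin t > 0" using assms by (intro sin_gt_zero) auto
  moreover have "1 + sin (2 * t) = (cos t + sin t)\<^sup>2" "1 - sin (2 * t) = (cos t - sin t)\<^sup>2"
    by (simp_all add: sin_double power2_sum power2_diff)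
  ultimately show "sqrt (1 + sin (2 * t)) = cos t + sin t"
      "sqrt (1 - sin (2 * t)) = cos t - sin t"
    by simp_all
qed

lemma shafer_fink_sin_double:
  assumes "0 < t" "t < pi / 4" "0 < \<alpha> + 2 * cos t"
  shows "shafer_fink C \<alpha> (sin (2 * t)) < arcsin (sin (2 * t)) \<longleftrightarrow> C < sf_quot \<alpha> t"
    and "arcsin (sin (2 * t)) < shafer_fink C \<alpha> (sin (2 * t)) \<longleftrightarrow> sf_quot \<alpha> t < C"
proof -
  have sin: "sin t > 0" using assms by (intro sin_gt_zero) auto
  have arc: "arcsin (sin (2 * t)) = 2 * t" using assms by (intro arcsin_sin) auto
  have sf: "shafer_fink C \<alpha> (sin (2 * t)) = 2 * (C * sin t) / (\<alpha> + 2 * cos t)"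
    unfolding shafer_fink_def sqrt_one_plus_minus_sin_double[OF assms(1,2)]
    by (simp add: algebra_simps)
  show "shafer_fink C \<alpha> (sin (2 * t)) < arcsin (sin (2 * t)) \<longleftrightarrow> C < sf_quot \<alpha> t"
       "arcsin (sin (2 * t)) < shafer_fink C \<alpha> (sin (2 * t)) \<longleftrightarrow> sf_quot \<alpha> t < C"
    unfolding arc sf sf_quot_def using assms sin
    by (simp_all add: pos_less_divide_eq pos_divide_less_eq)
qed

text \<open>The map from t to \<open>sin (2 * t)\<close> takes the open interval from 0 to
  \<open>pi / 4\<close> onto the one from 0 to 1; \<open>arcsin x / 2\<close> is a preimage of
  x.\<close>

lemma ball_sin_double:
  "(\<forall>x\<in>{0<..<1}. P x) \<longleftrightarrow> (\<forall>t\<in>{0<..<pi / 4}. P (sin (2 * t)))" for P :: "real \<Rightarrow> bool"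
proof (intro iffI ballI)
  fix t assume P: "\<forall>x\<in>{0<..<1}. P x" and t: "t \<in> {0<..<pi / 4}"
  have "sin (2 * t) > 0" using t by (intro sin_gt_zero) auto
  moreover have "sin (2 * t) < sin (pi / 2)" using t by (intro sin_monotone_2pi) auto
  ultimately show "P (sin (2 * t))" using P by simp
next
  fix x :: real assume P: "\<forall>t\<in>{0<..<pi / 4}. P (sin (2 * t))" and x: "x \<in> {0<..<1}"
  have "arcsin 0 < arcsin x" "arcsin x < arcsin 1"
    using x by (intro arcsin_less_arcsin; simp)+
  then have "arcsin x / 2 \<in> {0<..<pi / 4}" by simp
  with P have "P (sin (2 * (arcsin x / 2)))" by blast
  then show "P x" using x by simp
qed

lemma shafer_fink_less_arcsin_iff:
  assumes "0 \<le> \<alpha>"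
  shows "(\<forall>x\<in>{0<..<1}. shafer_fink C \<alpha> x < arcsin x) \<longleftrightarrow> (\<forall>t\<in>{0<..<pi / 4}. C < sf_quot \<alpha> t)"
  unfolding ball_sin_double[of "\<lambda>x. shafer_fink C \<alpha> x < arcsin x"]
  using assms by (intro ball_cong refl shafer_fink_sin_double add_nonneg_pos)
    (auto intro!: cos_gt_zero)

lemma arcsin_less_shafer_fink_iff:
  assumes "0 \<le> \<alpha>"
  shows "(\<forall>x\<in>{0<..<1}. arcsin x < shafer_fink C \<alpha> x) \<longleftrightarrow> (\<forall>t\<in>{0<..<pi / 4}. sf_quot \<alpha> t < C)"
  unfolding ball_sin_double[of "\<lambda>x. arcsin x < shafer_fink C \<alpha> x"]
  using assms by (intro ball_cong refl shafer_fink_sin_double add_nonneg_pos)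
    (auto intro!: cos_gt_zero)

section \<open>Optimality of the constants, by passing to the endpoint limits\<close>

lemma shafer_fink_lower_best:
  assumes "0 \<le> \<alpha>" "\<forall>x\<in>{0<..<1}. shafer_fink C \<alpha> x < arcsin x"
  shows "C \<le> const_zero \<alpha>"
proof (rule tendsto_lowerbound[OF sf_quot_tendsto_0])
  show "eventually (\<lambda>t. C \<le> sf_quot \<alpha> t) (at_right 0)"
    by (rule eventually_mono[OF eventually_at_right_0_pi_4])
      (use assms in \<open>simp add: shafer_fink_less_arcsin_iff less_imp_le\<close>)
qed simp

lemma shafer_fink_upper_best:
  assumes "0 \<le> \<alpha>" "\<forall>x\<in>{0<..<1}. arcsin x < shafer_fink C \<alpha> x"
  shows "const_zero \<alpha> \<le> C" "const_one \<alpha> \<le> C"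
proof -
  \<comment> \<open>A bound on the whole interval passes to the limits at both ends.\<close>
  have le: "sf_quot \<alpha> t \<le> C" if "t \<in> {0<..<pi / 4}" for t
    using assms that by (simp add: arcsin_less_shafer_fink_iff less_imp_le)
  show "const_zero \<alpha> \<le> C"
    by (rule tendsto_upperbound[OF sf_quot_tendsto_0
          eventually_mono[OF eventually_at_right_0_pi_4 le]]) simp_all
  show "const_one \<alpha> \<le> C"
    by (rule tendsto_upperbound[OF sf_quot_tendsto_pi_4
          eventually_mono[OF eventually_at_left_pi_4 le]]) simp_all
qed

(* In the third conjunct the guard on the denominator is needed: if alpha < - sqrt 2, the
   denominator vanishes or is negative for some x in (0,1), and wherever it is negative both
   reversed inequalities are false. *)
theorem theorem2:
  fixes \<alpha> :: real
  shows
    "(\<alpha> \<ge> 4 \<longrightarrow>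
        (\<forall>x\<in>{0<..<1}. shafer_fink (const_zero \<alpha>) \<alpha> x < arcsin x \<and>
                       arcsin x < shafer_fink (const_one \<alpha>) \<alpha> x)) \<and>
     (4 > \<alpha> \<and> \<alpha> > alpha_crit \<longrightarrow>
        (\<forall>x\<in>{0<..<1}. arcsin x < shafer_fink (max (const_zero \<alpha>) (const_one \<alpha>)) \<alpha> x)) \<and>
     (\<alpha> \<le> alpha_crit \<longrightarrow>
        (\<forall>x\<in>{0<..<1}. \<alpha> + sqrt (1 + x) + sqrt (1 - x) > 0 \<longrightarrow>
                       shafer_fink (const_zero \<alpha>) \<alpha> x > arcsin x \<and>
                       arcsin x > shafer_fink (const_one \<alpha>) \<alpha> x)) \<and>
     (\<alpha> \<ge> 4 \<longrightarrow>
        (\<forall>C > const_zero \<alpha>. \<not> (\<forall>x\<in>{0<..<1}. shafer_fink C \<alpha> x < arcsin x)) \<and>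
        (\<forall>C < const_one \<alpha>. \<not> (\<forall>x\<in>{0<..<1}. arcsin x < shafer_fink C \<alpha> x))) \<and>
     (4 > \<alpha> \<and> \<alpha> > alpha_crit \<longrightarrow>
        (\<forall>C < max (const_zero \<alpha>) (const_one \<alpha>).
           \<not> (\<forall>x\<in>{0<..<1}. arcsin x < shafer_fink C \<alpha> x)))"
proof -
  have a: "\<forall>x\<in>{0<..<1}. shafer_fink (const_zero \<alpha>) \<alpha> x < arcsin x"
      "\<forall>x\<in>{0<..<1}. arcsin x < shafer_fink (const_one \<alpha>) \<alpha> x" if "4 \<le> \<alpha>"
  proof -
    have "sf_threshold t \<le> \<alpha>" if "0 < t" "t < pi / 4" for t
      using sf_threshold_less_4[of t] that \<open>4 \<le> \<alpha>\<close> by auto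
    then show "\<forall>x\<in>{0<..<1}. shafer_fink (const_zero \<alpha>) \<alpha> x < arcsin x"
        "\<forall>x\<in>{0<..<1}. arcsin x < shafer_fink (const_one \<alpha>) \<alpha> x"
      using that by (auto simp: shafer_fink_less_arcsin_iff arcsin_less_shafer_fink_iff
          intro!: const_zero_less_sf_quot sf_quot_less_const_one)
  qed
  have b: "\<forall>x\<in>{0<..<1}. arcsin x < shafer_fink (max (const_zero \<alpha>) (const_one \<alpha>)) \<alpha> x"
    if "alpha_crit < \<alpha>"
  proof -
    have "sf_quot \<alpha> t < max (const_zero \<alpha>) (const_one \<alpha>)" if "t \<in> {0<..<pi / 4}" for t
    \<comment> \<open>In the first case \<open>sf_quot\<close> decreases up to t, so it is below its
      limit at 0; in the second it increases from t on, so it is below its value at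
      \<open>pi / 4\<close>.\<close>
    proof (cases "\<alpha> \<le> sf_threshold t")
      case True
      then show ?thesis using sf_quot_less_const_zero[of t \<alpha>] that by (simp add: less_max_iff_disj)
    next
      case False
      then show ?thesis using sf_quot_less_const_one[of t \<alpha>] that by (simp add: less_max_iff_disj)
    qed
    then show ?thesis
      using that alpha_crit_nonneg by (subst arcsin_less_shafer_fink_iff) auto
  qed
  have c: "\<forall>x\<in>{0<..<1}. \<alpha> + sqrt (1 + x) + sqrt (1 - x) > 0 \<longrightarrow>
             shafer_fink (const_zero \<alpha>) \<alpha> x > arcsin x \<and>
             arcsin x > shafer_fink (const_one \<alpha>) \<alpha> x" (is "\<forall>x\<in>_. ?P x")
    if "\<alpha> \<le> alpha_crit"
    \<comment> \<open>Since \<alpha> may be negative, the substitution is applied at each point,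
      with the guard supplying the positive denominator.\<close>
    unfolding ball_sin_double[of ?P]
  proof (intro ballI impI)
    fix t :: real
    assume t: "t \<in> {0<..<pi / 4}"
      and "\<alpha> + sqrt (1 + sin (2 * t)) + sqrt (1 - sin (2 * t)) > 0"
    then have "0 < \<alpha> + 2 * cos t"
      by (simp add: sqrt_one_plus_minus_sin_double)
    moreover have "\<alpha> \<le> sf_threshold t"
      using sf_threshold_strict_antimono[of t "pi / 4"] t that by (simp add: sf_threshold_pi_4)
    ultimately show "shafer_fink (const_zero \<alpha>) \<alpha> (sin (2 * t)) > arcsin (sin (2 * t)) \<and>
        arcsin (sin (2 * t)) > shafer_fink (const_one \<alpha>) \<alpha> (sin (2 * t))"
      using t that sf_quot_less_const_zero[of t \<alpha>] const_one_less_sf_quot[of t \<alpha>]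
      by (simp add: shafer_fink_sin_double)
  qed
  have d: "\<forall>C > const_zero \<alpha>. \<not> (\<forall>x\<in>{0<..<1}. shafer_fink C \<alpha> x < arcsin x)"
    if "0 \<le> \<alpha>"
    using shafer_fink_lower_best[OF that] by (meson not_le)
  have e: "\<forall>C < max (const_zero \<alpha>) (const_one \<alpha>). \<not> (\<forall>x\<in>{0<..<1}. arcsin x < shafer_fink C \<alpha> x)"
    if "0 \<le> \<alpha>"
    using shafer_fink_upper_best[OF that] by (meson not_le max.bounded_iff)
  show ?thesis
    \<comment> \<open>\<open>alpha_crit_nonneg\<close> gives \<open>0 \<le> \<alpha>\<close> for
      \<open>d\<close> and \<open>e\<close> when \<alpha> exceeds \<open>alpha_crit\<close>. A
      constant below \<open>const_one \<alpha>\<close> is also below the maximum, so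
      \<open>e\<close> settles the upper constants of both ranges.\<close>
    using a b c d e alpha_crit_nonneg by (simp add: less_max_iff_disj)
qed

end
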